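(* For a labeled acyclic digraph $G$ the following are equivalent: (i) For every interval $[x,y]$ of $G$ and every non-negative integer $k$, the number of rising paths from $x$ to $y$ of length $k$ equals the number of falling paths from $x$ to $y$ of length $k$. (ii) For every interval $[x,y]$ of $G$ and every even positive integer $k$, the number of rising paths from $x$ to $y$ of length $k$ equals the number of falling paths from $x$ to $y$ of length $k$. (iii) For every interval $[x,y]$ of $G$, the rising quasisymmetric function $F^R([x,y])$ belongs to the peak algebra $\Pi$.
   Context: A labeled acyclic digraph $G=(V,E)$ is a directed graph (multiple edges allowed) with no directed cycles, locally finite (finitely many directed paths between any two vertices), with a set $\Lambda$ carrying an arbitrary binary relation $\sim$ and labeling $\lambda:E\to\Lambda$. A path $(e_1,\dots,e_k)$ from $x$ to $y$ has $\operatorname{tail}(e_1)=x$, $\operatorname{head}(e_k)=y$, $\operatorname{head}(e_i)=\operatorname{tail}(e_{i+1})$; it is rising if $\lambda(e_i)\sim\lambda(e_{i+1})$ for all $i\le k-1$ and falling if $\lambda(e_i)\not\sim\lambda(e_{i+1})$ for all $i\le k-1$. $x\le y$ means there is a path from $x$ to $y$; the interval $[x,y]=\{z:x\le z\le y\}$ is the induced labeled subgraph, bounded with source $x$ and sink $y$. Quasisymmetric functions in $w_1,w_2,\dots$: $M_\alpha=\sum_{i_1<\dots<i_m}w_{i_1}^{\alpha_1}\cdots w_{i_m}^{\alpha_m}$ for a composition $\alpha=(\alpha_1,\dots,\alpha_m)$; compositions of $n$ ordered by $\alpha\le\beta$ iff $\beta$ refines $\alpha$; $L_\alpha=\sum_{\beta\ge\alpha}M_\beta$.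 For a label sequence $(\lambda_1,\dots,\lambda_n)$, $\rho^R$ is the composition of $n$ recording the lengths of the maximal runs obtained by cutting between positions $i,i+1$ exactly when $\lambda_i\not\sim\lambda_{i+1}$. $F^R([x,y])=\sum_p L_{\rho^R(\lambda(p))}$ over all paths $p$ from $x$ to $y$ ($=1$ if $x=y$). Let ${\bf a},{\bf b}$ be non-commuting variables, ${\bf c}={\bf a}+{\bf b}$, ${\bf d}={\bf a}{\bf b}+{\bf b}{\bf a}$, and $\mathbb{Z}\langle{\bf c},{\bf d}\rangle\subseteq\mathbb{Z}\langle{\bf a},{\bf b}\rangle$ the integer polynomials in ${\bf c},{\bf d}$. Let $\gamma:\mathbb{Z}\langle{\bf a},{\bf b}\rangle\to\mathrm{QSym}$ be the linear map with $\gamma(({\bf a}-{\bf b})^{\alpha_1-1}{\bf b}({\bf a}-{\bf b})^{\alpha_2-1}{\bf b}\cdots{\bf b}({\bf a}-{\bf b})^{\alpha_k-1})=M_{(\alpha_1,\dots,\alpha_k)}$ for all compositions (these elements form a basis). The peak algebra $\Pi$ is the $\mathbb{Z}$-span of $1$ together with $\gamma(\mathbb{Z}\langle{\bf c},{\bf d}\rangle)$. *)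

theory Defs
  imports
    "Graph_Theory.Graph_Theory"
    "HOL-Library.Poly_Mapping"
    "HOL-Library.Function_Algebras"
begin

section \<open>Labeled acyclic digraphs\<close>

text \<open>
  Multiple arcs are allowed, and neither the vertex set nor the arc set has to be finite.
  The labeling is an arbitrary function \<open>lab\<close> on the arc type, and the relation \<open>\<sim>\<close> is an
  arbitrary binary predicate \<open>R\<close> on the label type; neither is subject to any axiom, so they are
  not part of the locale.
\<close>

locale acyclic_locally_finite_digraph = wf_digraph +
  assumes no_directed_cycle: "\<not> (\<exists>p. cycle p)"
    and locally_finite: "finite {p. awalk x p y}"

definition interval :: "('v, 'e) pre_digraph \<Rightarrow> 'v \<Rightarrow> 'v \<Rightarrow> ('v, 'e) pre_digraph" where
  "interval G x y = G \<restriction> {z. x \<rightarrow>\<^sup>*\<^bsub>G\<^esub> z \<and> z \<rightarrow>\<^sup>*\<^bsub>G\<^esub> y}"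

definition rising_paths ::
    "('l \<Rightarrow> 'l \<Rightarrow> bool) \<Rightarrow> ('e \<Rightarrow> 'l) \<Rightarrow> ('v, 'e) pre_digraph \<Rightarrow> 'v \<Rightarrow> 'v \<Rightarrow> nat \<Rightarrow> 'e list set" where
  "rising_paths R lab G x y k =
    {p. pre_digraph.awalk G x p y \<and> length p = k \<and> successively R (map lab p)}"

definition falling_paths ::
    "('l \<Rightarrow> 'l \<Rightarrow> bool) \<Rightarrow> ('e \<Rightarrow> 'l) \<Rightarrow> ('v, 'e) pre_digraph \<Rightarrow> 'v \<Rightarrow> 'v \<Rightarrow> nat \<Rightarrow> 'e list set" where
  "falling_paths R lab G x y k =
    {p. pre_digraph.awalk G x p y \<and> length p = k \<and> successively (\<lambda>s t. \<not> R s t) (map lab p)}"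


section \<open>Quasisymmetric functions\<close>

text \<open>
  A formal power series over the integers is given by its coefficients on the monomials, a
  monomial being its finitely supported exponent function. The variables are indexed from 0
  rather than from 1. Only the (pointwise) additive structure of \<open>series\<close> is meaningful: the type
  class constants \<open>1\<close> and \<open>*\<close> on functions are pointwise too and are not those of power series.
\<close>

type_synonym series = "(nat \<Rightarrow>\<^sub>0 nat) \<Rightarrow> int"

definition zscale :: "int \<Rightarrow> series \<Rightarrow> series" where
  "zscale k f = (\<lambda>m. k * f m)"

definition composition :: "nat list \<Rightarrow> bool" where
  "composition \<alpha> \<longleftrightarrow> 0 \<notin> set \<alpha>"

text \<open>
  The coefficient of a monomial in \<open>M\<^sub>\<alpha>\<close> is the number of index sequences
  \<open>i\<^sub>1 < \<dots> < i\<^sub>m\<close> whose term is this monomial. In particular \<open>QM []\<close> is the constant series one.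
\<close>

definition QM :: "nat list \<Rightarrow> series" where
  "QM \<alpha> = (\<lambda>m. int (card {is. length is = length \<alpha> \<and> sorted_wrt (<) is \<and>
      m = (\<Sum>(i, k) \<leftarrow> zip is \<alpha>. Poly_Mapping.single i k)}))"

definition refines :: "nat list \<Rightarrow> nat list \<Rightarrow> bool" where
  "refines \<beta> \<alpha> \<longleftrightarrow> (\<exists>bs. concat bs = \<beta> \<and> map sum_list bs = \<alpha>)"

definition QL :: "nat list \<Rightarrow> series" where
  "QL \<alpha> = (\<Sum>\<beta> | composition \<beta> \<and> refines \<beta> \<alpha>. QM \<beta>)"

text \<open>The composition \<open>\<rho>\<^sup>R\<close> of run lengths of a label sequence.\<close>

fun run_lengths :: "('l \<Rightarrow> 'l \<Rightarrow> bool) \<Rightarrow> 'l list \<Rightarrow> nat list" where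
  "run_lengths R [] = []"
| "run_lengths R [s] = [1]"
| "run_lengths R (s # t # ls) =
    (let r = run_lengths R (t # ls) in if R s t then Suc (hd r) # tl r else 1 # r)"

definition rising_qsym ::
    "('l \<Rightarrow> 'l \<Rightarrow> bool) \<Rightarrow> ('e \<Rightarrow> 'l) \<Rightarrow> ('v, 'e) pre_digraph \<Rightarrow> 'v \<Rightarrow> 'v \<Rightarrow> series" where
  "rising_qsym R lab G x y =
    (\<Sum>p | pre_digraph.awalk G x p y. QL (run_lengths R (map lab p)))"


section \<open>Non-commutative polynomials\<close>

text \<open>
  Words in the letters \<open>a\<close>, \<open>b\<close> form a monoid, written additively so that \<open>word \<Rightarrow>\<^sub>0 int\<close> with its
  convolution product is the free associative ring on \<open>a\<close> and \<open>b\<close>.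
\<close>

datatype letter = LA | LB

datatype word = Word "letter list"

instantiation word :: monoid_add
begin

definition zero_word :: word where
  "0 = Word []"

fun plus_word :: "word \<Rightarrow> word \<Rightarrow> word" where
  "Word u + Word v = Word (u @ v)"

instance
proof
  fix u v w :: word
  show "u + v + w = u + (v + w)" by (cases u; cases v; cases w) simp
  show "0 + u = u" by (cases u) (simp add: zero_word_def)
  show "u + 0 = u" by (cases u) (simp add: zero_word_def)
qed

end

type_synonym ab_poly = "word \<Rightarrow>\<^sub>0 int"

definition va :: ab_poly where "va = Poly_Mapping.single (Word [LA]) 1"
definition vb :: ab_poly where "vb = Poly_Mapping.single (Word [LB]) 1"
definition vc :: ab_poly where "vc = va + vb"
definition vd :: ab_poly where "vd = va * vb + vb * va"

text \<open>The subring \<open>\<int>\<langle>c,d\<rangle>\<close>.\<close>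

inductive_set cd_polys :: "ab_poly set" where
  one: "1 \<in> cd_polys"
| c: "vc \<in> cd_polys"
| d: "vd \<in> cd_polys"
| uminus: "f \<in> cd_polys \<Longrightarrow> - f \<in> cd_polys"
| add: "f \<in> cd_polys \<Longrightarrow> g \<in> cd_polys \<Longrightarrow> f + g \<in> cd_polys"
| mult: "f \<in> cd_polys \<Longrightarrow> g \<in> cd_polys \<Longrightarrow> f * g \<in> cd_polys"


section \<open>The map \<open>\<gamma>\<close> and the peak algebra\<close>

text \<open>Left undefined on the empty list, which does not index a basis element.\<close>

fun ab_basis :: "nat list \<Rightarrow> ab_poly" where
  "ab_basis [k] = (va - vb) ^ (k - 1)"
| "ab_basis (k # l # ks) = (va - vb) ^ (k - 1) * vb * ab_basis (l # ks)"

text \<open>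
  Additive maps between abelian groups are the same as \<open>\<int>\<close>-linear maps. That there is exactly one
  such map with the prescribed values is \<open>ex1_gamma\<close> below.
\<close>

definition gamma :: "ab_poly \<Rightarrow> series" where
  "gamma = (THE g. Modules.additive g \<and>
     (\<forall>\<alpha>. composition \<alpha> \<and> \<alpha> \<noteq> [] \<longrightarrow> g (ab_basis \<alpha>) = QM \<alpha>))"

definition peak_algebra :: "series set" where
  "peak_algebra = module.span zscale (insert (QM []) (gamma ` cd_polys))"


subsection \<open>Well-definedness of \<open>\<gamma>\<close>\<close>

lemma module_zscale: "module zscale"
  by unfold_locales (auto simp: zscale_def fun_eq_iff algebra_simps)

lemma additive_mult_left:
  fixes h :: ab_poly
  shows "Modules.additive g \<Longrightarrow> Modules.additive (\<lambda>f. g (h * f))"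
  by (simp add: Modules.additive_def distrib_left)

lemma ab_poly_induct [case_names single add]:
  fixes f :: ab_poly
  assumes single: "\<And>w c. P (Poly_Mapping.single w c)"
    and add: "\<And>f g. P f \<Longrightarrow> P g \<Longrightarrow> P (f + g)"
  shows "P f"
proof (induction f rule: update_induct)
  case const
  show ?case using single[of undefined 0] by simp
next
  case (update f a b)
  have "Poly_Mapping.update a b f = f + Poly_Mapping.single a b"
    using update(1)
    by (intro poly_mapping_eqI)
      (auto simp: lookup_update lookup_add lookup_single when_def in_keys_iff)
  then show ?case using add single update by simp
qed

lemma additive_eqI:
  fixes g h :: "ab_poly \<Rightarrow> series"
  assumes "Modules.additive g" "Modules.additive h"
    and "\<And>w c. g (Poly_Mapping.single w c) = h (Poly_Mapping.single w c)"
  shows "g f = h f"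
  using assms by (induction f rule: ab_poly_induct) (simp_all add: Modules.additive_def)

lemma ab_basis_Cons: "l \<noteq> [] \<Longrightarrow> ab_basis (k # l) = (va - vb) ^ (k - 1) * vb * ab_basis l"
  by (cases l) auto

text \<open>
  The image under \<open>\<gamma>\<close> of a product \<open>ab_basis pre * b * (a - b)\<^sup>k * w\<close> with a word \<open>w\<close>, and
  its linear extension to polynomials in place of \<open>w\<close>.
\<close>

fun gamma_word :: "nat list \<Rightarrow> nat \<Rightarrow> letter list \<Rightarrow> series" where
  "gamma_word pre k [] = QM (pre @ [Suc k])"
| "gamma_word pre k (LB # w) = gamma_word (pre @ [Suc k]) 0 w"
| "gamma_word pre k (LA # w) = gamma_word pre (Suc k) w + gamma_word (pre @ [Suc k]) 0 w"

definition gamma_lin :: "nat list \<Rightarrow> nat \<Rightarrow> ab_poly \<Rightarrow> series" where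
  "gamma_lin pre k f = (\<Sum>w \<in> Poly_Mapping.keys f.
     zscale (Poly_Mapping.lookup f w) (case w of Word u \<Rightarrow> gamma_word pre k u))"

lemma gamma_lin_superset:
  assumes "finite A" "Poly_Mapping.keys f \<subseteq> A"
  shows "gamma_lin pre k f =
    (\<Sum>w \<in> A. zscale (Poly_Mapping.lookup f w) (case w of Word u \<Rightarrow> gamma_word pre k u))"
  unfolding gamma_lin_def
  by (rule sum.mono_neutral_left) (use assms in \<open>auto simp: in_keys_iff zscale_def fun_eq_iff\<close>)

lemma gamma_lin_additive: "Modules.additive (gamma_lin pre k)"
proof
  fix f g :: ab_poly
  let ?A = "Poly_Mapping.keys f \<union> Poly_Mapping.keys g"
  show "gamma_lin pre k (f + g) = gamma_lin pre k f + gamma_lin pre k g"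
    using Poly_Mapping.keys_add[of f g]
    by (simp add: gamma_lin_superset[of ?A] lookup_add sum.distrib
        module.scale_left_distrib[OF module_zscale])
qed

lemma gamma_lin_single:
  "gamma_lin pre k (Poly_Mapping.single (Word u) c) = zscale c (gamma_word pre k u)"
  by (auto simp: gamma_lin_def zscale_def fun_eq_iff)

lemma gamma_lin_vb: "gamma_lin pre k (vb * f) = gamma_lin (pre @ [Suc k]) 0 f"
proof (rule additive_eqI[of "\<lambda>f. gamma_lin pre k (vb * f)"])
  fix w :: word and c
  show "gamma_lin pre k (vb * Poly_Mapping.single w c) =
      gamma_lin (pre @ [Suc k]) 0 (Poly_Mapping.single w c)"
    by (cases w) (simp add: vb_def mult_single gamma_lin_single)
qed (intro additive_mult_left gamma_lin_additive)+

lemma gamma_lin_va: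
  "gamma_lin pre k (va * f) = gamma_lin pre (Suc k) f + gamma_lin (pre @ [Suc k]) 0 f"
proof (rule additive_eqI[of "\<lambda>f. gamma_lin pre k (va * f)"])
  show "Modules.additive (\<lambda>f. gamma_lin pre (Suc k) f + gamma_lin (pre @ [Suc k]) 0 f)"
    using gamma_lin_additive by (simp add: Modules.additive_def)
  fix w :: word and c
  show "gamma_lin pre k (va * Poly_Mapping.single w c) =
      gamma_lin pre (Suc k) (Poly_Mapping.single w c)
      + gamma_lin (pre @ [Suc k]) 0 (Poly_Mapping.single w c)"
    by (cases w) (simp add: va_def mult_single gamma_lin_single
        module.scale_right_distrib[OF module_zscale])
qed (intro additive_mult_left gamma_lin_additive)

lemma gamma_lin_power:
  "gamma_lin pre k ((va - vb) ^ j * f) = gamma_lin pre (k + j) f"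
proof (induction j arbitrary: k)
  case (Suc j)
  have *: "gamma_lin pre k ((va - vb) * h) = gamma_lin pre (Suc k) h" for h
    by (simp add: left_diff_distrib additive.diff[OF gamma_lin_additive] gamma_lin_va gamma_lin_vb)
  show ?case by (simp add: mult.assoc * Suc)
qed simp

lemma gamma_lin_basis:
  "composition \<alpha> \<Longrightarrow> \<alpha> \<noteq> [] \<Longrightarrow> gamma_lin pre 0 (ab_basis \<alpha>) = QM (pre @ \<alpha>)"
proof (induction \<alpha> arbitrary: pre rule: ab_basis.induct)
  case (1 k)
  have "(1 :: ab_poly) = Poly_Mapping.single (Word []) 1"
    by (simp add: zero_word_def flip: single_one)
  then have "gamma_lin pre (k - 1) 1 = QM (pre @ [Suc (k - 1)])"
    using gamma_lin_single[of pre "k - 1" "[]" 1] by (simp add: zscale_def)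
  then show ?case
    using gamma_lin_power[of pre 0 "k - 1" 1] 1 by (simp add: composition_def)
next
  case (2 k l ks)
  then show ?case by (simp add: mult.assoc gamma_lin_power gamma_lin_vb composition_def)
qed auto

lemma ab_basis_spans:
  fixes g :: "ab_poly \<Rightarrow> series"
  assumes "Modules.additive g" "\<And>\<alpha>. composition \<alpha> \<Longrightarrow> \<alpha> \<noteq> [] \<Longrightarrow> g (ab_basis \<alpha>) = 0"
  shows "g f = 0"
proof -
  define V where "V g \<longleftrightarrow> Modules.additive g \<and>
    (\<forall>\<alpha>. composition \<alpha> \<and> \<alpha> \<noteq> [] \<longrightarrow> g (ab_basis \<alpha>) = 0)" for g :: "ab_poly \<Rightarrow> series"
  have V_diff: "V (\<lambda>f. g ((va - vb) * f))" if "V g" for g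
    unfolding V_def
  proof (intro conjI allI impI)
    fix \<alpha> assume \<alpha>: "composition \<alpha> \<and> \<alpha> \<noteq> []"
    then obtain k ks where ks: "\<alpha> = Suc k # ks"
      by (cases \<alpha>) (auto simp: composition_def gr0_conv_Suc neq0_conv)
    have "(va - vb) * ab_basis \<alpha> = ab_basis (Suc (Suc k) # ks)"
      unfolding ks by (cases ks) (simp_all add: mult.assoc)
    moreover have "composition (Suc (Suc k) # ks)" using \<alpha> ks by (simp add: composition_def)
    ultimately show "g ((va - vb) * ab_basis \<alpha>) = 0" using that by (simp add: V_def)
  qed (use that in \<open>auto simp: V_def intro: additive_mult_left\<close>)
  have V_vb: "V (\<lambda>f. g (vb * f))" if "V g" for g
    unfolding V_def
  proof (intro conjI allI impI)
    fix \<alpha> assume \<alpha>: "composition \<alpha> \<and> \<alpha> \<noteq> []"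
    then have "composition (1 # \<alpha>)" "vb * ab_basis \<alpha> = ab_basis (1 # \<alpha>)"
      by (simp_all add: composition_def ab_basis_Cons)
    then show "g (vb * ab_basis \<alpha>) = 0" using that by (simp add: V_def)
  qed (use that in \<open>auto simp: V_def intro: additive_mult_left\<close>)
  have word: "g (Poly_Mapping.single (Word u) 1) = 0" if "V g" for g u
    using that
  proof (induction u arbitrary: g)
    case Nil
    have "(1 :: ab_poly) = Poly_Mapping.single (Word []) 1"
      by (simp add: zero_word_def flip: single_one)
    moreover have "ab_basis [1] = 1" "composition [1]" by (simp_all add: composition_def)
    ultimately show ?case using Nil unfolding V_def by (metis list.distinct(1))
  next
    case (Cons x u)
    let ?u = "Poly_Mapping.single (Word u) 1 :: ab_poly"
    have 1: "g ((va - vb) * ?u) = 0" "g (vb * ?u) = 0"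
      using Cons V_diff V_vb by blast+
    have "va * ?u = (va - vb) * ?u + vb * ?u" by (simp add: left_diff_distrib)
    then have "g (va * ?u) = 0"
      using 1 Cons.prems by (metis V_def Modules.additive_def add.right_neutral)
    moreover have "Poly_Mapping.single (Word (x # u)) 1 = (if x = LA then va else vb) * ?u"
      by (cases x) (simp_all add: va_def vb_def mult_single)
    ultimately show ?case using 1 by simp
  qed
  have g: "V g" using assms by (simp add: V_def)
  show ?thesis
  proof (induction f rule: ab_poly_induct)
    case (single w c)
    obtain u where w: "w = Word u" by (cases w)
    have ad: "Modules.additive (\<lambda>c. g (Poly_Mapping.single w c))"
      using assms(1) by (simp add: Modules.additive_def single_add)
    have nat: "g (Poly_Mapping.single w (int n)) = 0" for n
    proof (induction n)
      case 0
      show ?case using additive.zero[OF ad] by simp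
    next
      case (Suc n)
      have "g (Poly_Mapping.single w 1) = 0" using word[OF g] w by simp
      then show ?case using Suc additive.add[OF ad, of 1 "int n"] by simp
    qed
    show ?case
      using nat additive.minus[OF ad] by (cases c rule: int_cases2) auto
  next
    case (add f h)
    then show ?case using assms(1) by (simp add: Modules.additive_def)
  qed
qed

lemma ex1_gamma:
  "\<exists>!g. Modules.additive g \<and> (\<forall>\<alpha>. composition \<alpha> \<and> \<alpha> \<noteq> [] \<longrightarrow> g (ab_basis \<alpha>) = QM \<alpha>)"
proof (rule ex_ex1I)
  show "\<exists>g. Modules.additive g \<and> (\<forall>\<alpha>. composition \<alpha> \<and> \<alpha> \<noteq> [] \<longrightarrow> g (ab_basis \<alpha>) = QM \<alpha>)"
    using gamma_lin_additive[of "[]" 0] gamma_lin_basis[of _ "[]"]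
    by (intro exI[of _ "gamma_lin [] 0"]) simp
next
  fix g h :: "ab_poly \<Rightarrow> series"
  assume g: "Modules.additive g \<and> (\<forall>\<alpha>. composition \<alpha> \<and> \<alpha> \<noteq> [] \<longrightarrow> g (ab_basis \<alpha>) = QM \<alpha>)"
    and h: "Modules.additive h \<and> (\<forall>\<alpha>. composition \<alpha> \<and> \<alpha> \<noteq> [] \<longrightarrow> h (ab_basis \<alpha>) = QM \<alpha>)"
  have "Modules.additive (\<lambda>f. g f - h f)"
    using g h by (simp add: Modules.additive_def)
  then have "g f - h f = 0" for f
    by (rule ab_basis_spans) (use g h in simp)
  then show "g = h" by (simp add: fun_eq_iff)
qed

lemma gamma_additive: "Modules.additive gamma"
  and gamma_ab_basis: "composition \<alpha> \<Longrightarrow> \<alpha> \<noteq> [] \<Longrightarrow> gamma (ab_basis \<alpha>) = QM \<alpha>"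
  using theI'[OF ex1_gamma] unfolding gamma_def by blast+

end

theory Submission
  imports Defs
begin

text \<open>
  Under \<open>\<gamma>\<close> a path corresponds to the word with a letter \<open>a\<close> for each rise and \<open>b\<close> for each other
  pair of consecutive arcs, so (iii) says that the sum \<open>\<Psi>(x, y)\<close> of these words over the nonempty
  paths lies in \<open>\<int>\<langle>c,d\<rangle>\<close>. The numbers of rising and of falling paths of length \<open>k\<close> are the
  coefficients of \<open>a\<^sup>k\<^sup>-\<^sup>1\<close> and \<open>b\<^sup>k\<^sup>-\<^sup>1\<close> in \<open>\<Psi>\<close>, and exchanging \<open>a\<close> and \<open>b\<close> fixes \<open>c\<close> and \<open>d\<close>; this gives
  (iii) \<open>\<Longrightarrow>\<close> (i).

  For (ii) \<open>\<Longrightarrow>\<close> (i), let \<open>A\<^sub>k\<close> and \<open>B\<^sub>k\<close> be the matrices counting the rising and the falling paths.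
  Moving the arc at the cut gives \<open>\<Sum>\<^sub>k (-1)\<^sup>k A\<^sub>k B\<^sub>n\<^sub>-\<^sub>k = 0\<close>. If \<open>n\<close> is odd and \<open>A\<^sub>k = B\<^sub>k\<close> for all
  \<open>k < n\<close>, then subtracting the same identity with \<open>A\<close> and \<open>B\<close> exchanged leaves \<open>2 (B\<^sub>n - A\<^sub>n) = 0\<close>.

  For (i) \<open>\<Longrightarrow>\<close> (iii), put \<open>e = a - b\<close> and expand each word up to its first \<open>b\<close>, respectively \<open>a\<close>:
  \<open>\<Psi> = \<Phi>(e) (1 + b \<Psi>) = \<Phi>(-e) (1 + a \<Psi>)\<close> with \<open>\<Phi>(e) = \<Sum>\<^sub>k A\<^sub>k e\<^sup>k\<^sup>-\<^sup>1\<close>. In the sum of the two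
  expansions only \<open>c\<close> and even powers of \<open>e\<close> survive, and \<open>e\<^sup>2 = c\<^sup>2 - 2d\<close>, so by induction on
  the length \<open>2 \<Psi>\<close> lies in \<open>\<int>\<langle>c,d\<rangle>\<close>. Finally \<open>2 f \<in> \<int>\<langle>c,d\<rangle>\<close> implies \<open>f \<in> \<int>\<langle>c,d\<rangle>\<close>.
\<close>

section \<open>Words of label sequences\<close>

text \<open>The letters are arbitrary ring elements, so that one expansion serves for
  \<open>va\<close>, \<open>vb\<close> and, with \<open>R\<close> negated, for \<open>vb\<close>,
  \<open>va\<close>.\<close>

fun label_word :: "'r::ring_1 \<Rightarrow> 'r \<Rightarrow> ('l \<Rightarrow> 'l \<Rightarrow> bool) \<Rightarrow> 'l list \<Rightarrow> 'r" where
  "label_word u v R [] = 1"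
| "label_word u v R [s] = 1"
| "label_word u v R (s # t # ls) = (if R s t then u else v) * label_word u v R (t # ls)"

text \<open>What follows the initial stretch in an expansion: the letter \<open>v\<close> at the cut
  and the word of the remaining labels, or 1 if nothing remains.\<close>

definition label_tail :: "'r::ring_1 \<Rightarrow> 'r \<Rightarrow> ('l \<Rightarrow> 'l \<Rightarrow> bool) \<Rightarrow> 'l list \<Rightarrow> 'r" where
  "label_tail u v R ls = (if ls = [] then 1 else v * label_word u v R ls)"

lemma label_word_swap: "label_word v u (\<lambda>s t. \<not> R s t) ls = label_word u v R ls"
  by (induction u v R ls rule: label_word.induct) auto

text \<open>Writing \<open>u = (u - v) + v\<close> at the rising positions and expanding up to the first \<open>v\<close>.\<close>

lemma label_word_expand:
  fixes u v :: "'r::ring_1"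
  assumes "ls \<noteq> []"
  shows "label_word u v R ls =
    (\<Sum>j<length ls. of_bool (successively R (take (Suc j) ls)) * (u - v) ^ j
       * label_tail u v R (drop (Suc j) ls))"
  using assms
proof (induction u v R ls rule: label_word.induct)
  case (2 u v R s)
  then show ?case by (simp add: label_tail_def)
next
  case (3 u v R s t ls)
  \<comment> \<open>The term \<open>j = 0\<close> cuts after \<open>s\<close>; every later prefix
    contains the pair \<open>s\<close>, \<open>t\<close>, hence the factor
    \<open>of_bool (R s t)\<close>.\<close>
  have "(\<Sum>j<length (s # t # ls). of_bool (successively R (take (Suc j) (s # t # ls))) * (u - v) ^ j
       * label_tail u v R (drop (Suc j) (s # t # ls)))
    = v * label_word u v R (t # ls) + (\<Sum>j<length (t # ls). of_bool (R s t) * ((u - v) * 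
       (of_bool (successively R (take (Suc j) (t # ls))) * (u - v) ^ j
       * label_tail u v R (drop (Suc j) (t # ls)))))"
  proof -
    have "of_bool (successively R (take (Suc (Suc j)) (s # t # ls))) * (u - v) ^ Suc j
         * label_tail u v R (drop (Suc (Suc j)) (s # t # ls))
      = of_bool (R s t) * ((u - v) * (of_bool (successively R (take (Suc j) (t # ls))) * (u - v) ^ j
         * label_tail u v R (drop (Suc j) (t # ls))))" for j
      by (cases "R s t"; cases "successively R (t # take j ls)") (simp_all add: mult.assoc)
    then show ?thesis
      by (subst length_Cons, subst sum.lessThan_Suc_shift) (simp add: label_tail_def)
  qed
  also have "\<dots> = v * label_word u v R (t # ls) + of_bool (R s t) * ((u - v) * label_word u v R (t # ls))"
    by (subst "3.IH") (simp_all only: sum_distrib_left list.distinct simp_thms)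
  also have "\<dots> = label_word u v R (s # t # ls)"
    by (simp add: algebra_simps)
  finally show ?case by (rule sym)
qed simp

text \<open>The pair of labels at the cut is unconstrained, so the nonzero terms, if there are any,
  belong to two adjacent cuts and have opposite signs.\<close>

lemma alternating_rising_falling:
  assumes "ls \<noteq> []"
  shows "(\<Sum>k\<le>length ls. (-1) ^ k * (of_bool (successively R (take k ls))
     * of_bool (successively (\<lambda>s t. \<not> R s t) (drop k ls)))) = (0::int)"
  using assms
proof (induction ls rule: induct_list012)
  case (3 s t ls)
  let ?f = "\<lambda>ls k. (-1) ^ k * (of_bool (successively R (take k ls))
     * of_bool (successively (\<lambda>s t. \<not> R s t) (drop k ls))) :: int"
  have split: "(\<Sum>k\<le>length (s # t # ls). ?f (s # t # ls) k) =
      ?f (s # t # ls) 0 + (\<Sum>k\<le>length (t # ls). ?f (s # t # ls) (Suc k))"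
    by (subst length_Cons, subst sum.atMost_Suc_shift) simp
  show ?case
  proof (cases "R s t")
    case True
    \<comment> \<open>Cut 0 vanishes since \<open>s\<close>, \<open>t\<close> rises; the other cuts
      are those of \<open>t # ls\<close> with the sign reversed.\<close>
    have "?f (s # t # ls) (Suc k) = - ?f (t # ls) k" for k
      using True by (cases k) auto
    then have "(\<Sum>k\<le>length (t # ls). ?f (s # t # ls) (Suc k)) = 0"
      using 3 by (simp only: sum_negf) simp
    then show ?thesis using split True by simp
  next
    case False
    \<comment> \<open>Only the cuts just before and just after \<open>s\<close> can contribute, and
      they cancel.\<close>
    have "(\<Sum>k\<le>length (t # ls). ?f (s # t # ls) (Suc k)) = (\<Sum>k\<in>{0}. ?f (s # t # ls) (Suc k))"
      using False by (intro sum.mono_neutral_right) (auto simp: gr0_conv_Suc neq0_conv)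
    then show ?thesis using split False by simp
  qed
qed simp_all


section \<open>The ring \<open>\<int>\<langle>c,d\<rangle>\<close>\<close>

lemma of_int_single: "(of_int n :: ab_poly) = Poly_Mapping.single (Word []) n"
  using single_of_int[of n, where ?'a = word and ?'b = int] by (simp add: zero_word_def)

lemma lookup_of_int: "Poly_Mapping.lookup (of_int n :: ab_poly) (Word u) = (if u = [] then n else 0)"
  by (auto simp: of_int_single lookup_single when_def)

lemma lookup_letter_mult:
  fixes f :: ab_poly
  shows "Poly_Mapping.lookup (Poly_Mapping.single (Word [x]) 1 * f) (Word u) =
    (case u of [] \<Rightarrow> 0 | y # w \<Rightarrow> if x = y then Poly_Mapping.lookup f (Word w) else 0)"
proof (induction f rule: ab_poly_induct)
  case (single w c)
  then show ?case by (cases w) (auto simp: mult_single lookup_single when_def split: list.splits)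
next
  case (add f g)
  then show ?case by (auto simp: distrib_left lookup_add split: list.splits)
qed

lemmas lookup_va_mult = lookup_letter_mult[of LA, folded va_def]
lemmas lookup_vb_mult = lookup_letter_mult[of LB, folded vb_def]

lemma cd_zero: "0 \<in> cd_polys"
  using cd_polys.add[OF cd_polys.one cd_polys.uminus[OF cd_polys.one]] by simp

lemma cd_sum: "(\<And>i. i \<in> I \<Longrightarrow> f i \<in> cd_polys) \<Longrightarrow> sum f I \<in> cd_polys"
  by (induction I rule: infinite_finite_induct) (auto intro: cd_zero cd_polys.add)

lemma cd_diff: "f \<in> cd_polys \<Longrightarrow> g \<in> cd_polys \<Longrightarrow> f - g \<in> cd_polys"
  using cd_polys.add[of f "- g"] cd_polys.uminus[of g] by simp

lemma cd_of_nat: "of_nat n \<in> cd_polys"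
  by (induction n) (auto intro: cd_zero cd_polys.add cd_polys.one)

lemma cd_of_int: "of_int n \<in> cd_polys"
  by (cases n rule: int_cases2) (auto intro: cd_of_nat cd_polys.uminus)

lemma cd_power: "f \<in> cd_polys \<Longrightarrow> f ^ n \<in> cd_polys"
  by (induction n) (auto intro: cd_polys.one cd_polys.mult)

lemma diff_square_cd: "(va - vb) ^ 2 = vc * vc - (vd + vd)"
  by (simp add: power2_eq_square vc_def vd_def algebra_simps)

lemma even_power_diff_cd: "even j \<Longrightarrow> (va - vb) ^ j \<in> cd_polys"
  by (elim evenE, simp only: power_mult diff_square_cd)
    (intro cd_power cd_diff cd_polys.mult cd_polys.add cd_polys.c cd_polys.d)

text \<open>A normal form for \<open>\<int>\<langle>c,d\<rangle>\<close>, splitting off the first letter of each monomial.\<close>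

inductive_set cd_normal :: "ab_poly set" where
  zero: "0 \<in> cd_normal"
| step: "g \<in> cd_normal \<Longrightarrow> h \<in> cd_normal \<Longrightarrow> of_int n + vc * g + vd * h \<in> cd_normal"

lemma cd_normal_add: "f \<in> cd_normal \<Longrightarrow> g \<in> cd_normal \<Longrightarrow> f + g \<in> cd_normal"
proof (induction f arbitrary: g rule: cd_normal.induct)
  case (step g1 h1 n)
  note IH = step
  from \<open>g \<in> cd_normal\<close> show ?case
  proof (cases rule: cd_normal.cases)
    case zero
    then show ?thesis using IH cd_normal.step by simp
  next
    case (step g2 h2 m)
    have "of_int n + vc * g1 + vd * h1 + g =
        of_int (n + m) + vc * (g1 + g2) + vd * (h1 + h2)"
      using step by (simp add: algebra_simps)
    then show ?thesis using IH step by (metis cd_normal.step)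
  qed
qed simp

lemma cd_normal_uminus: "f \<in> cd_normal \<Longrightarrow> - f \<in> cd_normal"
proof (induction rule: cd_normal.induct)
  case (step g h n)
  have "- (of_int n + vc * g + vd * h) = of_int (- n) + vc * (- g) + vd * (- h)"
    by (simp add: algebra_simps)
  then show ?case using step by (metis cd_normal.step)
qed (simp add: cd_normal.zero)

lemma cd_normal_of_int_mult:
  assumes "f \<in> cd_normal"
  shows "of_int n * f \<in> cd_normal"
proof -
  have "of_nat k * f \<in> cd_normal" for k
    by (induction k) (auto simp: distrib_right intro: cd_normal.zero cd_normal_add assms)
  then show ?thesis
    by (cases n rule: int_cases2) (auto intro: cd_normal_uminus)
qed

lemma cd_normal_mult: "f \<in> cd_normal \<Longrightarrow> g \<in> cd_normal \<Longrightarrow> f * g \<in> cd_normal"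
proof (induction rule: cd_normal.induct)
  case (step g' h' n)
  have "(of_int n + vc * g' + vd * h') * g =
      of_int n * g + (of_int 0 + vc * (g' * g) + vd * (h' * g))"
    by (simp add: algebra_simps)
  then show ?case using step by (metis cd_normal.step cd_normal_add cd_normal_of_int_mult)
qed (simp add: cd_normal.zero)

lemma cd_polys_normal: "f \<in> cd_polys \<Longrightarrow> f \<in> cd_normal"
proof (induction rule: cd_polys.induct)
  case one
  show ?case using cd_normal.step[OF cd_normal.zero cd_normal.zero, of 1] by simp
next
  case c
  show ?case
    using cd_normal.step[OF cd_normal.step[OF cd_normal.zero cd_normal.zero, of 1] cd_normal.zero, of 0]
    by simp
next
  case d
  show ?case
    using cd_normal.step[OF cd_normal.zero cd_normal.step[OF cd_normal.zero cd_normal.zero, of 1], of 0]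
    by simp
qed (auto intro: cd_normal_add cd_normal_uminus cd_normal_mult)

text \<open>Evenness passes to \<open>n\<close>, \<open>g\<close> and \<open>h\<close> in
  \<open>n + c g + d h\<close>: stripping a first letter a or b leaves \<open>g + b h\<close> or
  \<open>g + a h\<close>, whose coefficients at a word \<open>b u\<close> differ by that of
  \<open>h\<close> at \<open>u\<close>.\<close>

lemma cd_normal_halve:
  assumes "g \<in> cd_normal" "\<And>w. even (Poly_Mapping.lookup g w)"
  shows "\<exists>f \<in> cd_polys. g = f + f"
  using assms
proof (induction rule: cd_normal.induct)
  case zero
  show ?case using cd_zero by force
next
  case (step g h n)
  let ?l = "\<lambda>f u. Poly_Mapping.lookup f (Word u)"
  define F where "F = of_int n + vc * g + vd * h"
  have F: "F = of_int n + va * (g + vb * h) + vb * (g + va * h)"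
    by (simp add: F_def vc_def vd_def algebra_simps)
  have "?l F [] = n"
    by (simp add: F lookup_add lookup_of_int lookup_va_mult lookup_vb_mult)
  then have "even n" using step.prems unfolding F_def by metis
  then obtain m where m: "n = m + m" by (metis evenE mult_2)
  have a: "?l F (LA # u) = ?l (g + vb * h) u" and b: "?l F (LB # u) = ?l (g + va * h) u" for u
    by (simp_all add: F lookup_add[of _ _ "Word (_ # _)"] lookup_of_int lookup_va_mult lookup_vb_mult)
  have ga: "even (?l (g + vb * h) u)" and gb: "even (?l (g + va * h) u)" for u
    using step.prems unfolding F_def[symmetric] by (simp_all flip: a b)
  have h: "even (?l h u)" for u
    using ga[of "LB # u"] gb[of "LB # u"] by (simp add: lookup_add lookup_va_mult lookup_vb_mult)
  have g: "even (?l g u)" for u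
    using ga[of u] h by (cases u) (auto simp: lookup_add lookup_vb_mult split: if_splits)
  obtain f1 where f1: "f1 \<in> cd_polys" "g = f1 + f1" using step.IH(1) g by (metis word.exhaust)
  obtain f2 where f2: "f2 \<in> cd_polys" "h = f2 + f2" using step.IH(2) h by (metis word.exhaust)
  have "of_int n + vc * g + vd * h =
      (of_int m + vc * f1 + vd * f2) + (of_int m + vc * f1 + vd * f2)"
    by (simp only: m f1(2) f2(2) of_int_add distrib_left add_ac)
  moreover have "of_int m + vc * f1 + vd * f2 \<in> cd_polys"
    using f1 f2 by (intro cd_polys.add cd_polys.mult cd_of_int cd_polys.c cd_polys.d)
  ultimately show ?case by blast
qed

text \<open>The half found by \<open>cd_normal_halve\<close> must be \<open>f\<close>, as integer
  coefficients are determined by their doubles.\<close>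

lemma cd_halve:
  assumes "f + f \<in> cd_polys"
  shows "f \<in> cd_polys"
proof -
  have "even (Poly_Mapping.lookup (f + f) w)" for w by (simp add: lookup_add)
  then obtain g where g: "g \<in> cd_polys" "f + f = g + g"
    using cd_normal_halve[OF cd_polys_normal[OF assms]] by blast
  have "Poly_Mapping.lookup f w = Poly_Mapping.lookup g w" for w
    using arg_cong[OF g(2), of "\<lambda>h. Poly_Mapping.lookup h w"] by (simp add: lookup_add)
  then show ?thesis using g(1) by (metis poly_mapping_eqI)
qed

section \<open>Coefficients at the powers of a single letter\<close>

text \<open>A power of one letter factors only into powers of that letter, so these coefficients
  multiply as for polynomials in one variable.\<close>

lemma lookup_mult_replicate:
  fixes f g :: ab_poly
  shows "Poly_Mapping.lookup (f * g) (Word (replicate k x)) =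
    (\<Sum>i\<le>k. Poly_Mapping.lookup f (Word (replicate i x))
       * Poly_Mapping.lookup g (Word (replicate (k - i) x)))"
proof (induction f rule: ab_poly_induct)
  case (single w c)
  show ?case
  proof (induction g rule: ab_poly_induct)
    case (single w' c')
    obtain u u' where [simp]: "w = Word u" "w' = Word u'" by (cases w; cases w')
    have *: "u = replicate i x \<and> u' = replicate (k - i) x \<longleftrightarrow>
        i = length u \<and> u @ u' = replicate k x" if "i \<le> k" for i
    proof
      assume "u = replicate i x \<and> u' = replicate (k - i) x"
      then show "i = length u \<and> u @ u' = replicate k x"
        using that by (simp flip: replicate_add)
    next
      assume "i = length u \<and> u @ u' = replicate k x"
      then show "u = replicate i x \<and> u' = replicate (k - i) x"
        using that by (metis append_eq_conv_conj take_replicate drop_replicate min_absorb1)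
    qed
    have len: "length u \<le> k" if "u @ u' = replicate k x"
      using that by (metis length_append length_replicate le_add1)
    have "(\<Sum>i\<le>k. Poly_Mapping.lookup (Poly_Mapping.single w c) (Word (replicate i x))
       * Poly_Mapping.lookup (Poly_Mapping.single w' c') (Word (replicate (k - i) x)))
       = (\<Sum>i\<le>k. if u = replicate i x \<and> u' = replicate (k - i) x then c * c' else 0)"
      by (intro sum.cong refl) (auto simp: lookup_single when_def)
    also have "\<dots> = (\<Sum>i\<le>k. if i = length u then (if u @ u' = replicate k x then c * c' else 0) else 0)"
      by (intro sum.cong refl if_cong[OF *, THEN trans]) auto
    also have "\<dots> = (if u @ u' = replicate k x then c * c' else 0)"
      using len by auto
    finally show ?case by (simp add: mult_single lookup_single when_def)
  qed (simp add: distrib_left lookup_add sum.distrib)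
qed (simp add: distrib_right lookup_add sum.distrib)

text \<open>Restricting the a-b symmetry to powers of one letter keeps it stable under products, by
  \<open>lookup_mult_replicate\<close>.\<close>

lemma cd_symmetric:
  assumes "f \<in> cd_polys"
  shows "Poly_Mapping.lookup f (Word (replicate k LA)) = Poly_Mapping.lookup f (Word (replicate k LB))"
  using assms
proof (induction arbitrary: k rule: cd_polys.induct)
  case one
  show ?case using lookup_of_int[of 1] by simp
next
  case c
  have "replicate k y = [x] \<longleftrightarrow> k = 1 \<and> x = y" for x y :: letter
    by (cases k) auto
  then show ?case
    by (auto simp: vc_def va_def vb_def lookup_add lookup_single when_def eq_commute[of "[_]"])
next
  case d
  show ?case
    by (cases k; cases "k - 1")
      (auto simp: vd_def lookup_add lookup_va_mult lookup_vb_mult, auto simp: va_def vb_def lookup_single when_def)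
qed (simp_all add: lookup_add lookup_mult_replicate)


section \<open>Injectivity of \<open>\<gamma>\<close>\<close>

text \<open>The monomial of \<open>QM \<beta>\<close> in the first \<open>length \<beta>\<close>
  variables; evaluating there reads off the coordinate at \<open>QM \<beta>\<close>.\<close>

definition comp_monomial :: "nat list \<Rightarrow> (nat \<Rightarrow>\<^sub>0 nat)" where
  "comp_monomial \<beta> = (\<Sum>(i, k) \<leftarrow> zip [0..<length \<beta>] \<beta>. Poly_Mapping.single i k)"

lemma lookup_sum_single_zip:
  fixes idx :: "'i list" and \<alpha> :: "'k::comm_monoid_add list"
  assumes "length idx = length \<alpha>" "distinct idx"
  shows "Poly_Mapping.lookup (\<Sum>(i, k) \<leftarrow> zip idx \<alpha>. Poly_Mapping.single i k) x =
    (case map_of (zip idx \<alpha>) x of None \<Rightarrow> 0 | Some k \<Rightarrow> k)"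
  using assms
proof (induction idx \<alpha> rule: list_induct2)
  case (Cons i idx k \<alpha>)
  then have "map_of (zip idx \<alpha>) i = None" by (simp add: map_of_zip_is_None)
  then have "Poly_Mapping.lookup (\<Sum>(i, k) \<leftarrow> zip idx \<alpha>. Poly_Mapping.single i k) i = 0"
    if "x = i" using Cons that by (simp only: option.case distinct.simps)
  then show ?case
    using Cons by (cases "x = i") (simp_all add: lookup_add lookup_single when_def)
qed simp

text \<open>No part of a composition is zero, so the indices are exactly the variables that occur,
  and their exponents in increasing order of index are the parts.\<close>

lemma monomial_decomposition_unique:
  fixes idx idy :: "nat list"
  assumes "composition \<alpha>" "composition \<beta>" "sorted_wrt (<) idx" "sorted_wrt (<) idy"
    and len: "length idx = length \<alpha>" "length idy = length \<beta>"
    and eq: "(\<Sum>(i, k) \<leftarrow> zip idx \<alpha>. Poly_Mapping.single i k) =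
      (\<Sum>(i, k) \<leftarrow> zip idy \<beta>. Poly_Mapping.single i k)"
  shows "idx = idy \<and> \<alpha> = \<beta>"
proof -
  let ?m = "\<lambda>idx \<alpha>. (\<Sum>(i, k) \<leftarrow> zip idx \<alpha>. Poly_Mapping.single i k) :: nat \<Rightarrow>\<^sub>0 nat"
  have nth: "Poly_Mapping.lookup (?m idx \<alpha>) (idx ! i) = \<alpha> ! i"
    if "length idx = length \<alpha>" "sorted_wrt (<) idx" "i < length \<alpha>" for i idx \<alpha>
    using that strict_sorted_iff[of idx]
    by (simp add: lookup_sum_single_zip map_of_zip_nth)
  have out: "Poly_Mapping.lookup (?m idx \<alpha>) x = 0"
    if "length idx = length \<alpha>" "sorted_wrt (<) idx" "x \<notin> set idx" for x idx \<alpha>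
  proof -
    have "map_of (zip idx \<alpha>) x = None" using that(1,3) by (simp add: map_of_zip_is_None)
    then show ?thesis using that(1,2) strict_sorted_iff[of idx] by (simp only: lookup_sum_single_zip option.case)
  qed
  have keys: "x \<in> set idx \<longleftrightarrow> Poly_Mapping.lookup (?m idx \<alpha>) x \<noteq> 0"
    if "length idx = length \<alpha>" "sorted_wrt (<) idx" "composition \<alpha>" for x idx \<alpha>
    using nth[OF that(1,2)] out[OF that(1,2)] that(1,3) unfolding composition_def
    by (metis in_set_conv_nth)
  have "set idx = set idy" using keys assms by (metis set_eqI)
  then have "idx = idy" using strict_sorted_equal assms(3,4) by metis
  moreover from this have "\<alpha> = \<beta>"
    using nth[OF len(1) assms(3)] nth[OF len(2) assms(4)] len eq
    by (intro nth_equalityI) auto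
  ultimately show ?thesis by simp
qed

lemma QM_comp_monomial:
  assumes "composition \<alpha>" "composition \<beta>"
  shows "QM \<alpha> (comp_monomial \<beta>) = of_bool (\<alpha> = \<beta>)"
proof -
  have "{idx. length idx = length \<alpha> \<and> sorted_wrt (<) idx \<and>
      comp_monomial \<beta> = (\<Sum>(i, k) \<leftarrow> zip idx \<alpha>. Poly_Mapping.single i k)}
    = (if \<alpha> = \<beta> then {[0..<length \<beta>]} else {})"
    using monomial_decomposition_unique[OF assms(2,1), of "[0..<length \<beta>]"]
    by (auto simp: comp_monomial_def sorted_wrt_upt)
  then show ?thesis by (simp add: QM_def)
qed

lemma finite_compositions: "finite {\<beta>. composition \<beta> \<and> sum_list \<beta> = n}"
proof (rule finite_subset)
  have "length \<beta> \<le> sum_list \<beta>" if "0 \<notin> set \<beta>" for \<beta> :: "nat list"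
    using that by (induction \<beta>) auto
  then show "{\<beta>. composition \<beta> \<and> sum_list \<beta> = n} \<subseteq> {\<beta>. set \<beta> \<subseteq> {..n} \<and> length \<beta> \<le> n}"
    by (auto simp: composition_def dest: member_le_sum_list)
qed (simp add: finite_lists_length_le)

section \<open>Degrees, and coordinates in the basis \<open>ab_basis\<close>\<close>

definition ab_homogeneous :: "nat \<Rightarrow> ab_poly \<Rightarrow> bool" where
  "ab_homogeneous n f \<longleftrightarrow> (\<forall>u. Poly_Mapping.lookup f (Word u) \<noteq> 0 \<longrightarrow> length u = n)"

lemma ab_homogeneous_mult:
  assumes "ab_homogeneous m f" "ab_homogeneous n g"
  shows "ab_homogeneous (m + n) (f * g)"
  unfolding ab_homogeneous_def
proof (intro allI impI)
  fix u assume "Poly_Mapping.lookup (f * g) (Word u) \<noteq> 0"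
  then obtain v w where vw: "Word u = v + w" "Poly_Mapping.lookup f v \<noteq> 0" "Poly_Mapping.lookup g w \<noteq> 0"
    using keys_mult[of f g] by (auto simp: in_keys_iff)
  then show "length u = m + n"
    using assms by (cases v; cases w) (auto simp: ab_homogeneous_def)
qed

lemma ab_homogeneous_one: "ab_homogeneous 0 1"
  using lookup_of_int[of 1] by (auto simp: ab_homogeneous_def)

lemma ab_homogeneous_vb: "ab_homogeneous 1 vb"
  by (auto simp: ab_homogeneous_def vb_def lookup_single when_def)

lemma ab_homogeneous_diff_power: "ab_homogeneous n ((va - vb) ^ n)"
proof (induction n)
  case (Suc n)
  have "ab_homogeneous 1 (va - vb)"
    by (auto simp: ab_homogeneous_def va_def vb_def lookup_minus lookup_single when_def split: if_splits)
  then show ?case using ab_homogeneous_mult[OF _ Suc] by fastforce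
qed (simp add: ab_homogeneous_one)

text \<open>Each part \<open>k\<close> contributes degree \<open>k - 1\<close>, and each gap between
  parts one letter b.\<close>

lemma ab_homogeneous_basis:
  "composition \<alpha> \<Longrightarrow> \<alpha> \<noteq> [] \<Longrightarrow> ab_homogeneous (sum_list \<alpha> - 1) (ab_basis \<alpha>)"
proof (induction \<alpha> rule: ab_basis.induct)
  case (1 k)
  then show ?case by (simp add: ab_homogeneous_diff_power)
next
  case (2 k l ks)
  then have "ab_homogeneous (k - 1 + 1 + (sum_list (l # ks) - 1)) (ab_basis (k # l # ks))"
    unfolding ab_basis.simps
    by (intro ab_homogeneous_mult ab_homogeneous_diff_power ab_homogeneous_vb)
      (auto simp: composition_def)
  moreover have "k - 1 + 1 + (sum_list (l # ks) - 1) = sum_list (k # l # ks) - 1"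
    using 2 by (auto simp: composition_def)
  ultimately show ?case by metis
qed auto

text \<open>Expresses the coefficients of a polynomial through its coordinates in the basis
  \<open>ab_basis\<close>, which are the coefficients of its image at the monomials \<open>comp_monomial\<close>.\<close>

lemma lookup_eq_sum_gamma:
  "Poly_Mapping.lookup f (Word u) =
    (\<Sum>\<beta> | composition \<beta> \<and> sum_list \<beta> = Suc (length u).
       Poly_Mapping.lookup (ab_basis \<beta>) (Word u) * gamma f (comp_monomial \<beta>))"
proof -
  let ?C = "{\<beta>. composition \<beta> \<and> sum_list \<beta> = Suc (length u)}"
  \<comment> \<open>The difference of the two sides, made a constant function because
    \<open>ab_basis_spans\<close> is about series-valued maps.\<close>
  define g where "g f = (\<lambda>_ :: nat \<Rightarrow>\<^sub>0 nat. Poly_Mapping.lookup f (Word u) -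
    (\<Sum>\<beta>\<in>?C. Poly_Mapping.lookup (ab_basis \<beta>) (Word u) * gamma f (comp_monomial \<beta>)))" for f
  have "g f = 0"
  proof (rule ab_basis_spans)
    show "Modules.additive g"
      using gamma_additive
      by (auto simp: Modules.additive_def g_def fun_eq_iff lookup_add distrib_left sum.distrib)
  next
    fix \<alpha> assume \<alpha>: "composition \<alpha>" "\<alpha> \<noteq> []"
    then obtain n where n: "sum_list \<alpha> = Suc n"
      by (cases \<alpha>; cases "hd \<alpha>") (auto simp: composition_def)
    have "(\<Sum>\<beta>\<in>?C. Poly_Mapping.lookup (ab_basis \<beta>) (Word u) * gamma (ab_basis \<alpha>) (comp_monomial \<beta>)) =
        (\<Sum>\<beta>\<in>?C. if \<beta> = \<alpha> then Poly_Mapping.lookup (ab_basis \<alpha>) (Word u) else 0)"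
      using \<alpha> by (intro sum.cong) (auto simp: gamma_ab_basis QM_comp_monomial)
    also have "\<dots> = (if \<alpha> \<in> ?C then Poly_Mapping.lookup (ab_basis \<alpha>) (Word u) else 0)"
      using finite_compositions by (simp add: sum.delta)
    also have "\<dots> = Poly_Mapping.lookup (ab_basis \<alpha>) (Word u)"
    proof (cases "Poly_Mapping.lookup (ab_basis \<alpha>) (Word u) = 0")
      case False
      then have "length u = sum_list \<alpha> - 1"
        using ab_homogeneous_basis[OF \<alpha>] by (simp add: ab_homogeneous_def)
      then show ?thesis using \<alpha> n by simp
    qed simp
    finally show "g (ab_basis \<alpha>) = 0" by (simp add: g_def fun_eq_iff)
  qed
  then show ?thesis by (simp add: g_def fun_eq_iff)
qed

lemma gamma_inj: "gamma f = gamma g \<Longrightarrow> f = g"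
  by (rule poly_mapping_eqI) (metis lookup_eq_sum_gamma word.exhaust)

text \<open>Only nonempty compositions index \<open>ab_basis\<close>. This separates the image of
  \<open>gamma\<close> from the multiples of \<open>QM []\<close>.\<close>

lemma gamma_no_constant_term: "gamma f 0 = 0"
proof -
  have 0: "comp_monomial [] = 0" by (simp add: comp_monomial_def)
  have "(\<lambda>_ :: nat \<Rightarrow>\<^sub>0 nat. gamma f 0) = 0"
  proof (rule ab_basis_spans[of "\<lambda>f _. gamma f 0"])
    show "Modules.additive (\<lambda>f (_ :: nat \<Rightarrow>\<^sub>0 nat). gamma f 0)"
      using gamma_additive by (auto simp: Modules.additive_def)
  next
    fix \<alpha> assume "composition \<alpha>" "\<alpha> \<noteq> []"
    then show "(\<lambda>_ :: nat \<Rightarrow>\<^sub>0 nat. gamma (ab_basis \<alpha>) 0) = 0"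
      using QM_comp_monomial[of \<alpha> "[]"]
      by (simp add: gamma_ab_basis 0 composition_def fun_eq_iff)
  qed
  then show ?thesis by (simp add: fun_eq_iff)
qed

lemma gamma_of_int_mult: "gamma (of_int k * f) = zscale k (gamma f)"
proof -
  have nat: "gamma (of_nat n * f) = zscale (int n) (gamma f)" for n
    by (induction n)
      (simp_all add: additive.zero[OF gamma_additive] additive.add[OF gamma_additive]
        distrib_right zscale_def fun_eq_iff)
  show ?thesis
    by (cases k rule: int_cases2)
      (simp_all add: nat additive.minus[OF gamma_additive], simp add: zscale_def fun_eq_iff)
qed

text \<open>The image of \<open>cd_polys\<close> is already a submodule, so the span adds only
  multiples of \<open>QM []\<close>; comparing constant terms fixes the multiple, and
  \<open>gamma_inj\<close> does the rest.\<close>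

lemma gamma_peak_algebra_iff:
  "zscale c (QM []) + gamma f \<in> peak_algebra \<longleftrightarrow> f \<in> cd_polys"
proof -
  have "module.subspace zscale (gamma ` cd_polys)"
    unfolding module.subspace_def[OF module_zscale]
  proof (intro conjI ballI allI)
    show "0 \<in> gamma ` cd_polys"
      using imageI[OF cd_zero, of gamma] by (simp add: additive.zero[OF gamma_additive])
    show "x + y \<in> gamma ` cd_polys" if "x \<in> gamma ` cd_polys" "y \<in> gamma ` cd_polys" for x y
      using that by (auto simp flip: additive.add[OF gamma_additive] intro!: imageI cd_polys.add)
    show "zscale k x \<in> gamma ` cd_polys" if "x \<in> gamma ` cd_polys" for k x
    proof -
      from that obtain f where "f \<in> cd_polys" "x = gamma f" by blast
      then show ?thesis
        by (intro image_eqI[of _ _ "of_int k * f"] cd_polys.mult cd_of_int)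
          (simp_all add: gamma_of_int_mult)
    qed
  qed
  then have span: "module.span zscale (gamma ` cd_polys) = gamma ` cd_polys"
    using module.span_eq_iff[OF module_zscale] by blast
  have QM0: "QM [] 0 = 1"
    using QM_comp_monomial[of "[]" "[]"] by (simp add: comp_monomial_def composition_def)
  have "zscale c (QM []) + gamma f \<in> peak_algebra \<longleftrightarrow>
      (\<exists>k. zscale c (QM []) + gamma f - zscale k (QM []) \<in> gamma ` cd_polys)"
    unfolding peak_algebra_def module.span_breakdown_eq[OF module_zscale] span ..
  also have "\<dots> \<longleftrightarrow> f \<in> cd_polys"
  proof
    assume "\<exists>k. zscale c (QM []) + gamma f - zscale k (QM []) \<in> gamma ` cd_polys"
    then obtain k g where g: "g \<in> cd_polys" "zscale c (QM []) + gamma f - zscale k (QM []) = gamma g"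
      by blast
    from fun_cong[OF g(2), of 0] have "c = k"
      by (simp add: gamma_no_constant_term QM0 zscale_def)
    then have "gamma f = gamma g" using g(2) by simp
    then show "f \<in> cd_polys" using g(1) gamma_inj by blast
  next
    assume "f \<in> cd_polys"
    then show "\<exists>k. zscale c (QM []) + gamma f - zscale k (QM []) \<in> gamma ` cd_polys"
      by (intro exI[of _ c]) simp
  qed
  finally show ?thesis .
qed


section \<open>The fundamental basis as the image of words\<close>

definition refinements :: "nat list \<Rightarrow> nat list set" where
  "refinements \<alpha> = {\<beta>. composition \<beta> \<and> refines \<beta> \<alpha>}"

lemma refinementsI: "composition (concat bs) \<Longrightarrow> concat bs \<in> refinements (map sum_list bs)"
  by (auto simp: refinements_def refines_def)

lemma finite_refinements: "finite (refinements \<alpha>)"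
proof (rule finite_subset)
  have "sum_list (concat bs) = sum_list (map sum_list bs)" for bs :: "nat list list"
    by (induction bs) auto
  then show "refinements \<alpha> \<subseteq> {\<beta>. composition \<beta> \<and> sum_list \<beta> = sum_list \<alpha>}"
    by (auto simp: refinements_def refines_def)
qed (rule finite_compositions)

lemma refinements_Nil: "refinements [] = {[]}"
  by (auto simp: refinements_def refines_def composition_def)

lemma refinements_ConsE:
  assumes "\<beta> \<in> refinements (Suc k # \<alpha>)"
  obtains x xs bs where "\<beta> = Suc x # xs @ concat bs" "x + sum_list xs = k" "map sum_list bs = \<alpha>"
    "composition (xs @ concat bs)"
proof -
  obtain b bs where b: "\<beta> = b @ concat bs" "sum_list b = Suc k" "map sum_list bs = \<alpha>" "composition \<beta>"
    using assms by (auto simp: refinements_def refines_def map_eq_Cons_conv)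
  then obtain y xs where y: "b = y # xs" by (cases b) auto
  with b obtain x where "y = Suc x" by (cases y) (auto simp: composition_def)
  then show thesis using b y that[of x xs bs] by (auto simp: composition_def)
qed

lemma refinements_one: "refinements (1 # \<alpha>) = (#) 1 ` refinements \<alpha>"
proof (intro equalityI subsetI)
  fix \<beta> assume "\<beta> \<in> refinements (1 # \<alpha>)"
  then obtain x xs bs where *: "\<beta> = Suc x # xs @ concat bs" "x + sum_list xs = 0"
      "map sum_list bs = \<alpha>" "composition (xs @ concat bs)"
    by (auto intro: refinements_ConsE[of \<beta> 0 \<alpha>])
  moreover from this have "xs = []" by (cases xs) (auto simp: composition_def)
  ultimately show "\<beta> \<in> (#) 1 ` refinements \<alpha>" using refinementsI[of bs] by auto
next
  fix \<beta> assume "\<beta> \<in> (#) 1 ` refinements \<alpha>"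
  then obtain bs where "\<beta> = 1 # concat bs" "map sum_list bs = \<alpha>" "composition (concat bs)"
    by (auto simp: refinements_def refines_def)
  then show "\<beta> \<in> refinements (1 # \<alpha>)"
    using refinementsI[of "[1] # bs"] by (auto simp: composition_def)
qed

text \<open>A refinement either starts with a part 1, which can be removed, or has a first part that
  can be lowered by one.\<close>

lemma refinements_Suc:
  "refinements (Suc (Suc k) # \<alpha>) = (\<lambda>\<beta>. Suc (hd \<beta>) # tl \<beta>) ` refinements (Suc k # \<alpha>)
    \<union> (#) 1 ` refinements (Suc k # \<alpha>)" (is "?L = ?A \<union> ?B")
proof (intro equalityI subsetI)
  fix \<beta> assume "\<beta> \<in> ?L"
  then obtain x xs bs where *: "\<beta> = Suc x # xs @ concat bs" "x + sum_list xs = Suc k"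
      "map sum_list bs = \<alpha>" "composition (xs @ concat bs)"
    by (rule refinements_ConsE)
  show "\<beta> \<in> ?A \<union> ?B"
  proof (cases x)
    case 0
    then show ?thesis using * refinementsI[of "xs # bs"] by auto
  next
    case (Suc y)
    have "x # xs @ concat bs \<in> refinements (Suc k # \<alpha>)"
      using * Suc refinementsI[of "(x # xs) # bs"] by (auto simp: composition_def)
    then show ?thesis
      using * by (intro UnI1 image_eqI[of _ _ "x # xs @ concat bs"]) simp_all
  qed
next
  fix \<beta> assume "\<beta> \<in> ?A \<union> ?B"
  then obtain \<beta>' where \<beta>': "\<beta>' \<in> refinements (Suc k # \<alpha>)" "\<beta> = Suc (hd \<beta>') # tl \<beta>' \<or> \<beta> = 1 # \<beta>'"
    by auto
  from \<beta>'(1) obtain x xs bs where *: "\<beta>' = Suc x # xs @ concat bs" "x + sum_list xs = k"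
      "map sum_list bs = \<alpha>" "composition (xs @ concat bs)"
    by (rule refinements_ConsE)
  then show "\<beta> \<in> ?L"
    using \<beta>'(2) refinementsI[of "(Suc (Suc x) # xs) # bs"] refinementsI[of "(1 # Suc x # xs) # bs"]
    by (auto simp: composition_def)
qed

text \<open>The two sums match the two terms of \<open>gamma_lin_va\<close>. The union is disjoint
  because first parts are at least 2 on one side and 1 on the other.\<close>

lemma sum_refinements_Suc:
  fixes h :: "nat list \<Rightarrow> 'b::comm_monoid_add"
  shows "sum h (refinements (Suc (Suc k) # \<alpha>)) =
    (\<Sum>\<beta>\<in>refinements (Suc k # \<alpha>). h (Suc (hd \<beta>) # tl \<beta>)) + (\<Sum>\<beta>\<in>refinements (Suc k # \<alpha>). h (1 # \<beta>))"
proof -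
  have ne: "\<exists>x xs. \<beta> = Suc x # xs" if "\<beta> \<in> refinements (Suc k # \<alpha>)" for \<beta>
    using that by (rule refinements_ConsE) simp
  have inj: "inj_on (\<lambda>\<beta>. Suc (hd \<beta>) # tl \<beta>) (refinements (Suc k # \<alpha>))"
    by (rule inj_onI) (drule ne, drule ne, auto)
  have "(\<lambda>\<beta>. Suc (hd \<beta>) # tl \<beta>) ` refinements (Suc k # \<alpha>) \<inter> (#) 1 ` refinements (Suc k # \<alpha>) = {}"
    by (auto dest!: ne)
  then show ?thesis
    unfolding refinements_Suc
    by (simp add: sum.union_disjoint finite_refinements sum.reindex inj o_def)
qed

lemma run_lengths_nonempty: "ls \<noteq> [] \<Longrightarrow> \<exists>k r. run_lengths R ls = Suc k # r"
  by (induction R ls rule: run_lengths.induct) (auto simp: Let_def)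

text \<open>The shift \<open>k\<close> counts factors \<open>a - b\<close> already absorbed by the
  current part. As \<open>a = (a - b) + b\<close>, a letter a either lengthens this part or closes
  it, while b only closes it; refinements of the run lengths obey the same recursion.\<close>

lemma gamma_lin_label_word:
  "ls \<noteq> [] \<Longrightarrow> gamma_lin pre k (label_word va vb R ls) =
    (\<Sum>\<beta>\<in>refinements (run_lengths R ls). QM (pre @ (hd \<beta> + k) # tl \<beta>))"
proof (induction R ls arbitrary: pre k rule: run_lengths.induct)
  case (2 R s)
  have "(1 :: ab_poly) = Poly_Mapping.single (Word []) 1"
    using of_int_single[of 1] by simp
  then have "gamma_lin pre k 1 = QM (pre @ [Suc k])"
    using gamma_lin_single[of pre k "[]" 1] by (simp add: zscale_def)
  then show ?case using refinements_one[of "[]"] by (simp add: refinements_Nil)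
next
  case (3 R s t ls)
  obtain j r where r: "run_lengths R (t # ls) = Suc j # r"
    using run_lengths_nonempty[of "t # ls"] by blast
  have hd_tl: "hd \<beta> # tl \<beta> = \<beta>" if "\<beta> \<in> refinements (Suc j # r)" for \<beta>
    using that by (rule refinements_ConsE) simp
  have tail: "gamma_lin (pre @ [Suc k]) 0 (label_word va vb R (t # ls)) =
      (\<Sum>\<beta>\<in>refinements (Suc j # r). QM (pre @ Suc k # \<beta>))"
    using "3.IH"[of "pre @ [Suc k]" 0] by (simp add: r hd_tl)
  show ?case
  proof (cases "R s t")
    case True
    then show ?thesis
      using "3.IH"[of pre "Suc k"]
      by (simp add: r gamma_lin_va tail sum_refinements_Suc)
  next
    case False
    then show ?thesis
      by (simp add: r gamma_lin_vb tail refinements_one[simplified] sum.reindex)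
  qed
qed simp

lemma gamma_label_word:
  assumes "ls \<noteq> []"
  shows "gamma (label_word va vb R ls) = QL (run_lengths R ls)"
proof -
  have "gamma = gamma_lin [] 0"
    unfolding gamma_def
    by (rule the1_equality[OF ex1_gamma])
      (use gamma_lin_additive[of "[]" 0] gamma_lin_basis[of _ "[]"] in simp)
  moreover have "hd \<beta> # tl \<beta> = \<beta>" if "\<beta> \<in> refinements (run_lengths R ls)" for \<beta>
  proof -
    obtain k r where "run_lengths R ls = Suc k # r" using run_lengths_nonempty[OF assms] by blast
    then show ?thesis using that by (auto intro: refinements_ConsE[of \<beta> k r])
  qed
  ultimately show ?thesis
    using gamma_lin_label_word[OF assms, of "[]" 0 R] by (simp add: QL_def refinements_def)
qed


text \<open>The shift by one arises because \<open>Suc k\<close> labels have \<open>k\<close>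
  consecutive pairs.\<close>

lemma lookup_label_word_LA:
  "ls \<noteq> [] \<Longrightarrow> Poly_Mapping.lookup (label_word va vb R ls) (Word (replicate k LA)) =
    of_bool (length ls = Suc k \<and> successively R ls)"
proof (induction ls arbitrary: k rule: induct_list012)
  case (2 s)
  then show ?case using lookup_of_int[of 1] by (simp add: eq_commute[of 0])
next
  case (3 s t ls)
  then show ?case by (cases k) (auto simp: lookup_va_mult lookup_vb_mult)
qed simp

lemma lookup_label_word_LB:
  "ls \<noteq> [] \<Longrightarrow> Poly_Mapping.lookup (label_word va vb R ls) (Word (replicate k LB)) =
    of_bool (length ls = Suc k \<and> successively (\<lambda>s t. \<not> R s t) ls)"
proof (induction ls arbitrary: k rule: induct_list012)
  case (2 s)
  then show ?case using lookup_of_int[of 1] by (simp add: eq_commute[of 0])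
next
  case (3 s t ls)
  then show ?case by (cases k) (auto simp: lookup_va_mult lookup_vb_mult)
qed simp


section \<open>Sums over paths\<close>

context acyclic_locally_finite_digraph
begin

definition awalks :: "nat \<Rightarrow> 'a \<Rightarrow> 'a \<Rightarrow> 'b list set" where
  "awalks n x y = {p. awalk x p y \<and> length p = n}"

definition between :: "'a \<Rightarrow> 'a \<Rightarrow> 'a set" where
  "between x y = {z. x \<rightarrow>\<^sup>* z \<and> z \<rightarrow>\<^sup>* y}"

lemma finite_awalks: "finite (awalks n x y)"
  using locally_finite[of x y] by (rule rev_finite_subset) (auto simp: awalks_def)

text \<open>Every such vertex lies on one of the finitely many paths from \<open>x\<close> to
  \<open>y\<close>.\<close>

lemma finite_between: "finite (between x y)"
proof (rule finite_subset)
  show "finite (\<Union>p\<in>{p. awalk x p y}. set (awalk_verts x p))"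
    using locally_finite by auto
  show "between x y \<subseteq> (\<Union>p\<in>{p. awalk x p y}. set (awalk_verts x p))"
  proof
    fix z assume "z \<in> between x y"
    then obtain p q where pq: "awalk x p z" "awalk z q y"
      by (auto simp: between_def reachable_awalk)
    have "awlast x p = z" using pq(1) by (rule awalkE)
    then have "z \<in> set (awalk_verts x p)" by (metis awalk_verts_non_Nil last_in_set)
    then have "z \<in> set (awalk_verts x (p @ q))"
      using awalk_verts_append[OF awalk_appendI[OF pq]] by simp
    then show "z \<in> (\<Union>p\<in>{p. awalk x p y}. set (awalk_verts x p))"
      using pq awalk_appendI by blast
  qed
qed

text \<open>Cutting after \<open>k\<close> arcs is a bijection onto triples of a cut vertex and two
  paths, so the sum is an entry of a matrix product; the order of the factors is kept for
  noncommuting values.\<close>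

lemma sum_awalks_split:
  fixes g h :: "'b list \<Rightarrow> 'r::semiring_0"
  assumes "k \<le> n"
  shows "(\<Sum>p\<in>awalks n x y. g (take k p) * h (drop k p)) =
    (\<Sum>z\<in>between x y. (\<Sum>q\<in>awalks k x z. g q) * (\<Sum>r\<in>awalks (n - k) z y. h r))"
proof -
  have "(\<Sum>z\<in>between x y. (\<Sum>q\<in>awalks k x z. g q) * (\<Sum>r\<in>awalks (n - k) z y. h r)) =
      (\<Sum>(z, q, r)\<in>Sigma (between x y) (\<lambda>z. awalks k x z \<times> awalks (n - k) z y). g q * h r)"
    by (simp add: sum_product sum.cartesian_product sum.Sigma finite_awalks finite_between)
  also have "\<dots> = (\<Sum>p\<in>awalks n x y. g (take k p) * h (drop k p))"
  proof (rule sum.reindex_bij_witness[of _ "\<lambda>p. (awlast x (take k p), take k p, drop k p)"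
        "\<lambda>(z, q, r). q @ r"], goal_cases)
    case (1 t)
    then show ?case by (auto simp: awalks_def awalk_def awlast_if_cas)
  next
    case (2 t)
    then show ?case using assms by (auto simp: awalks_def intro: awalk_appendI)
  next
    case (3 p)
    then show ?case by simp
  next
    case (4 p)
    then have "awalk x (take k p @ drop k p) y" by (simp add: awalks_def)
    then have "awalk x (take k p) (awlast x (take k p))" "awalk (awlast x (take k p)) (drop k p) y"
      unfolding awalk_append_iff by blast+
    then show ?case using 4 assms by (auto simp: awalks_def between_def intro: reachable_awalkI)
  next
    case (5 t)
    then show ?case by (auto simp: awalks_def)
  qed
  finally show ?thesis by simp
qed

section \<open>Rising against falling paths, and the passage from even to odd lengths\<close>

lemma rising_paths_awalks:
  "rising_paths R lab G x y k = {p \<in> awalks k x y. successively R (map lab p)}"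
  by (auto simp: rising_paths_def awalks_def)

lemma sum_of_bool_rising:
  "(\<Sum>p\<in>awalks k x y. of_bool (successively R (map lab p))) =
    (of_nat (card (rising_paths R lab G x y k)) :: 'r::semiring_1)"
  by (simp add: rising_paths_awalks finite_awalks Int_def)

lemma alternating_path_sum:
  assumes "n > 0"
  shows "(\<Sum>k\<le>n. (-1) ^ k * (\<Sum>p\<in>awalks n x y. of_bool (successively R (map lab (take k p)))
     * of_bool (successively (\<lambda>s t. \<not> R s t) (map lab (drop k p))))) = (0::int)"
proof -
  have "(\<Sum>k\<le>n. (-1) ^ k * (\<Sum>p\<in>awalks n x y. of_bool (successively R (map lab (take k p)))
     * of_bool (successively (\<lambda>s t. \<not> R s t) (map lab (drop k p))))) =
    (\<Sum>p\<in>awalks n x y. \<Sum>k\<le>n. (-1) ^ k * (of_bool (successively R (take k (map lab p)))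
     * of_bool (successively (\<lambda>s t. \<not> R s t) (drop k (map lab p)))) :: int)"
    unfolding sum_distrib_left by (subst sum.swap) (simp add: take_map drop_map)
  also have "\<dots> = 0"
  proof (rule sum.neutral, rule ballI)
    fix p assume "p \<in> awalks n x y"
    then show "(\<Sum>k\<le>n. (-1) ^ k * (of_bool (successively R (take k (map lab p)))
       * of_bool (successively (\<lambda>s t. \<not> R s t) (drop k (map lab p)))) :: int) = 0"
      using alternating_rising_falling[of "map lab p" R] assms by (auto simp: awalks_def)
  qed
  finally show ?thesis .
qed

text \<open>After the subtraction only the cuts at the two ends survive. For odd \<open>n\<close>
  their signs make them add up, whereas for even \<open>n\<close> they would cancel.\<close>

lemma odd_rising_eq_falling:
  fixes R :: "'c \<Rightarrow> 'c \<Rightarrow> bool"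
  assumes n: "odd n"
    and less: "\<And>k x y. k < n \<Longrightarrow> card (rising_paths R lab G x y k) =
      card (rising_paths (\<lambda>s t. \<not> R s t) lab G x y k)"
  shows "card (rising_paths R lab G x y n) = card (rising_paths (\<lambda>s t. \<not> R s t) lab G x y n)"
proof -
  define T :: "('c \<Rightarrow> 'c \<Rightarrow> bool) \<Rightarrow> ('c \<Rightarrow> 'c \<Rightarrow> bool) \<Rightarrow> nat \<Rightarrow> int" where
    "T Q Q' k = (\<Sum>p\<in>awalks n x y. of_bool (successively Q (map lab (take k p)))
       * of_bool (successively Q' (map lab (drop k p))))" for Q Q' k
  let ?R = "\<lambda>s t. \<not> R s t"
  have n0: "n > 0" using n by (rule odd_pos)
  have sums: "(\<Sum>k\<le>n. (-1) ^ k * T R ?R k) = 0" "(\<Sum>k\<le>n. (-1) ^ k * T ?R R k) = 0"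
    using alternating_path_sum[OF n0, where R = R and lab = lab and x = x and y = y]
      alternating_path_sum[OF n0, where R = ?R and lab = lab and x = x and y = y]
    by (simp_all add: T_def)
  have split: "T Q Q' k = (\<Sum>z\<in>between x y. of_nat (card (rising_paths Q lab G x z k))
      * of_nat (card (rising_paths Q' lab G z y (n - k))))" if "k \<le> n" for Q Q' k
    unfolding T_def by (subst sum_awalks_split[OF that]) (simp add: sum_of_bool_rising)
  \<comment> \<open>At an inner cut both pieces are shorter than \<open>n\<close>, so the hypothesis
    exchanges the relations in each factor.\<close>
  have mid: "T R ?R k = T ?R R k" if "k \<le> n" "k \<noteq> 0" "k \<noteq> n" for k
    using that by (simp add: split less)
  have T0: "T Q Q' 0 = int (card (rising_paths Q' lab G x y n))" for Q Q'
    by (simp add: T_def sum_of_bool_rising)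
  have Tn: "T Q Q' n = int (card (rising_paths Q lab G x y n))" for Q Q'
  proof -
    have "T Q Q' n = (\<Sum>p\<in>awalks n x y. of_bool (successively Q (map lab p)))"
      unfolding T_def by (intro sum.cong) (auto simp: awalks_def)
    then show ?thesis by (simp add: sum_of_bool_rising)
  qed
  have "0 = (\<Sum>k\<le>n. (-1) ^ k * (T R ?R k - T ?R R k))"
    using sums by (simp add: right_diff_distrib sum_subtractf)
  also have "\<dots> = (\<Sum>k\<in>{0, n}. (-1) ^ k * (T R ?R k - T ?R R k))"
    by (rule sum.mono_neutral_right) (use mid in auto)
  also have "\<dots> = 2 * (int (card (rising_paths ?R lab G x y n)) - int (card (rising_paths R lab G x y n)))"
    using n n0 by (simp add: T0 Tn)
  finally show ?thesis by simp
qed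

lemma rising_eq_falling_if_even:
  assumes "\<And>k x y. even k \<Longrightarrow> k > 0 \<Longrightarrow> card (rising_paths R lab G x y k) =
      card (rising_paths (\<lambda>s t. \<not> R s t) lab G x y k)"
  shows "card (rising_paths R lab G x y n) = card (rising_paths (\<lambda>s t. \<not> R s t) lab G x y n)"
proof (induction n arbitrary: x y rule: less_induct)
  case (less n)
  consider "n = 0" | "even n" "n > 0" | "odd n" by blast
  then show ?case
  proof cases
    case 1
    \<comment> \<open>The assumption omits length 0, but the empty path satisfies every
      relation.\<close>
    have "rising_paths Q lab G x y 0 = {p. p = [] \<and> awalk x p y}" for Q
      by (auto simp: rising_paths_def)
    then show ?thesis using 1 by simp
  next
    case 2
    then show ?thesis using assms by simp
  next
    case 3
    then show ?thesis using less by (rule odd_rising_eq_falling)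
  qed
qed

section \<open>Path sums as cd-polynomials\<close>

text \<open>Summed over paths, the rising prefixes in \<open>label_word_expand\<close> become path
  counts; a prefix of \<open>Suc j\<close> arcs has \<open>j\<close> pairs, hence the exponent
  \<open>j\<close>.\<close>

lemma sum_label_word_expand:
  fixes u v :: "'r::ring_1"
  assumes "n > 0"
  shows "(\<Sum>p\<in>awalks n x y. label_word u v R (map lab p)) =
    (\<Sum>j<n. \<Sum>z\<in>between x y. of_nat (card (rising_paths R lab G x z (Suc j)))
       * ((u - v) ^ j * (\<Sum>r\<in>awalks (n - Suc j) z y. label_tail u v R (map lab r))))"
proof -
  have "label_word u v R (map lab p) = (\<Sum>j<n. of_bool (successively R (map lab (take (Suc j) p)))
      * (u - v) ^ j * label_tail u v R (map lab (drop (Suc j) p)))" if "p \<in> awalks n x y" for p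
    using that assms label_word_expand[of "map lab p" u v R]
    by (auto simp: awalks_def take_map drop_map)
  then have "(\<Sum>p\<in>awalks n x y. label_word u v R (map lab p)) =
      (\<Sum>j<n. \<Sum>p\<in>awalks n x y. of_bool (successively R (map lab (take (Suc j) p)))
        * (u - v) ^ j * label_tail u v R (map lab (drop (Suc j) p)))"
    by (subst sum.swap) (rule sum.cong[OF refl])
  also have "\<dots> = (\<Sum>j<n. \<Sum>z\<in>between x y. of_nat (card (rising_paths R lab G x z (Suc j)))
       * ((u - v) ^ j * (\<Sum>r\<in>awalks (n - Suc j) z y. label_tail u v R (map lab r))))"
  proof (rule sum.cong[OF refl])
    fix j assume "j \<in> {..<n}"
    then have j: "Suc j \<le> n" by simp
    show "(\<Sum>p\<in>awalks n x y. of_bool (successively R (map lab (take (Suc j) p)))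
        * (u - v) ^ j * label_tail u v R (map lab (drop (Suc j) p))) =
      (\<Sum>z\<in>between x y. of_nat (card (rising_paths R lab G x z (Suc j)))
       * ((u - v) ^ j * (\<Sum>r\<in>awalks (n - Suc j) z y. label_tail u v R (map lab r))))"
      using sum_awalks_split[OF j, of "\<lambda>q. of_bool (successively R (map lab q)) * (u - v) ^ j"
          "\<lambda>r. label_tail u v R (map lab r)" x y]
      by (simp only: sum_distrib_right[symmetric] sum_of_bool_rising mult.assoc)
  qed
  finally show ?thesis .
qed

text \<open>Adding the expansion of \<open>label_word_expand\<close> to the one with \<open>a\<close> and \<open>b\<close> exchanged leaves only
  even powers of \<open>a - b\<close>, and \<open>(a - b)\<^sup>2 = c\<^sup>2 - 2d\<close>.\<close>

lemma sum_label_word_in_cd: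
  assumes eq: "\<And>k x y. card (rising_paths R lab G x y k) =
      card (rising_paths (\<lambda>s t. \<not> R s t) lab G x y k)"
    and "n > 0"
  shows "(\<Sum>p\<in>awalks n x y. label_word va vb R (map lab p)) \<in> cd_polys"
  using \<open>n > 0\<close>
proof (induction n arbitrary: x y rule: less_induct)
  case (less n)
  let ?R = "\<lambda>s t. \<not> R s t"
  let ?N = "\<lambda>x z k. of_nat (card (rising_paths R lab G x z k)) :: ab_poly"
  define \<Psi> where "\<Psi> n x y = (\<Sum>p\<in>awalks n x y. label_word va vb R (map lab p))" for n x y
  \<comment> \<open>The cofactor of the common count of rising and falling paths when the two
    expansions are added.\<close>
  define X where "X j m z = (va - vb) ^ j * (\<Sum>r\<in>awalks m z y. label_tail va vb R (map lab r))
    + (vb - va) ^ j * (\<Sum>r\<in>awalks m z y. label_tail vb va ?R (map lab r))" for j m z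
  have sign: "(vb - va) ^ j = (if even j then (va - vb) ^ j else - ((va - vb) ^ j))" for j
    using power_minus_even[of j "va - vb"] power_minus_odd[of j "va - vb"] by simp
  have X: "X j m z \<in> cd_polys" if "m < n" for j m z
  proof (cases "m = 0")
    case True
    have "label_tail a b Q (map lab r) = 1" if "r \<in> awalks 0 z y" for r Q and a b :: ab_poly
      using that by (simp add: awalks_def label_tail_def)
    \<comment> \<open>With no arcs left both tails are 1, so the odd powers of \<open>a - b\<close>
      cancel.\<close>
    then have "X j m z = (va - vb) ^ j * of_nat (card (awalks 0 z y))
        + (vb - va) ^ j * of_nat (card (awalks 0 z y))"
      by (simp add: X_def True)
    then show ?thesis
      by (auto simp: sign intro!: cd_zero cd_polys.add cd_polys.mult even_power_diff_cd cd_of_nat)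
  next
    case False
    then have "label_tail a b Q (map lab r) = b * label_word a b Q (map lab r)"
      if "r \<in> awalks m z y" for r Q and a b :: ab_poly
      using that by (auto simp: awalks_def label_tail_def)
    then have X_eq: "X j m z = (va - vb) ^ j * (vb * \<Psi> m z y) + (vb - va) ^ j * (va * \<Psi> m z y)"
      by (simp add: X_def \<Psi>_def sum_distrib_left label_word_swap)
    have \<Psi>: "\<Psi> m z y \<in> cd_polys"
      using less.IH[OF that] False by (simp add: \<Psi>_def)
    show ?thesis
    proof (cases "even j")
      case True
      then have "X j m z = (va - vb) ^ j * (vc * \<Psi> m z y)"
        by (simp add: X_eq sign vc_def algebra_simps)
      then show ?thesis
        using True \<Psi> by (auto intro!: cd_polys.mult even_power_diff_cd cd_polys.c)
    next
      case False
      \<comment> \<open>The odd power gains one more factor \<open>a - b\<close> from the difference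
        of the tails and becomes even.\<close>
      then have "X j m z = - ((va - vb) ^ j * ((va - vb) * \<Psi> m z y))"
        by (simp add: X_eq sign algebra_simps)
      also have "\<dots> = - ((va - vb) ^ Suc j * \<Psi> m z y)"
        by (simp only: power_Suc2 mult.assoc)
      finally show ?thesis
        using False \<Psi> by (auto intro!: cd_polys.uminus cd_polys.mult even_power_diff_cd simp del: power_Suc)
    qed
  qed
  have "\<Psi> n x y = (\<Sum>p\<in>awalks n x y. label_word vb va ?R (map lab p))"
    by (simp add: \<Psi>_def label_word_swap)
  then have "\<Psi> n x y + \<Psi> n x y =
      (\<Sum>j<n. \<Sum>z\<in>between x y. ?N x z (Suc j) * X j (n - Suc j) z)"
    unfolding X_def distrib_left sum.distrib
    using sum_label_word_expand[OF less.prems, of va vb R lab x y]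
      sum_label_word_expand[OF less.prems, of vb va ?R lab x y]
    by (simp add: \<Psi>_def eq)
  also have "\<dots> \<in> cd_polys"
    using less.prems by (auto intro!: cd_sum cd_polys.mult cd_of_nat X)
  finally show ?case
    unfolding \<Psi>_def by (rule cd_halve)
qed

text \<open>The empty path is left out because it contributes the constant \<open>QM []\<close>,
  which is not in the image of \<open>gamma\<close>.\<close>

definition path_poly :: "('c \<Rightarrow> 'c \<Rightarrow> bool) \<Rightarrow> ('b \<Rightarrow> 'c) \<Rightarrow> 'a \<Rightarrow> 'a \<Rightarrow> ab_poly" where
  "path_poly R lab x y = (\<Sum>p | awalk x p y \<and> p \<noteq> []. label_word va vb R (map lab p))"

lemma finite_nonempty_walks: "finite {p. awalk x p y \<and> p \<noteq> []}"
  using locally_finite[of x y] by (rule rev_finite_subset) auto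

lemma lookup_path_poly:
  "Poly_Mapping.lookup (path_poly R lab x y) (Word (replicate k LA)) =
    int (card (rising_paths R lab G x y (Suc k)))"
  "Poly_Mapping.lookup (path_poly R lab x y) (Word (replicate k LB)) =
    int (card (rising_paths (\<lambda>s t. \<not> R s t) lab G x y (Suc k)))"
proof -
  have sum: "(\<Sum>p | awalk x p y \<and> p \<noteq> []. of_bool (length p = Suc k \<and> successively Q (map lab p))) =
    int (card (rising_paths Q lab G x y (Suc k)))" for Q
  proof -
    have "{p. awalk x p y \<and> p \<noteq> []} \<inter> {p. length p = Suc k \<and> successively Q (map lab p)}
        = rising_paths Q lab G x y (Suc k)"
      by (auto simp: rising_paths_def)
    then show ?thesis using finite_nonempty_walks by (simp add: sum_of_bool_eq)
  qed
  show "Poly_Mapping.lookup (path_poly R lab x y) (Word (replicate k LA)) =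
      int (card (rising_paths R lab G x y (Suc k)))"
    unfolding path_poly_def lookup_sum sum[symmetric]
    by (intro sum.cong) (auto simp: lookup_label_word_LA)
  show "Poly_Mapping.lookup (path_poly R lab x y) (Word (replicate k LB)) =
      int (card (rising_paths (\<lambda>s t. \<not> R s t) lab G x y (Suc k)))"
    unfolding path_poly_def lookup_sum sum[symmetric]
    by (intro sum.cong) (auto simp: lookup_label_word_LB)
qed

lemma path_poly_in_cd_imp:
  assumes "path_poly R lab x y \<in> cd_polys" "k > 0"
  shows "card (rising_paths R lab G x y k) = card (rising_paths (\<lambda>s t. \<not> R s t) lab G x y k)"
  using cd_symmetric[OF assms(1), of "k - 1"] assms(2) by (simp add: lookup_path_poly)

lemma path_poly_in_cd:
  assumes "\<And>k x y. card (rising_paths R lab G x y k) =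
      card (rising_paths (\<lambda>s t. \<not> R s t) lab G x y k)"
  shows "path_poly R lab x y \<in> cd_polys"
proof -
  let ?P = "{p. awalk x p y \<and> p \<noteq> []}"
  have "path_poly R lab x y =
      (\<Sum>n\<in>length ` ?P. \<Sum>p\<in>{p. p \<in> ?P \<and> length p = n}. label_word va vb R (map lab p))"
    unfolding path_poly_def by (rule sum.image_gen[OF finite_nonempty_walks])
  also have "\<dots> = (\<Sum>n\<in>length ` ?P. \<Sum>p\<in>awalks n x y. label_word va vb R (map lab p))"
    by (intro sum.cong) (auto simp: awalks_def)
  also have "\<dots> \<in> cd_polys"
  proof (rule cd_sum)
    fix n assume "n \<in> length ` ?P"
    then have "n > 0" by auto
    then show "(\<Sum>p\<in>awalks n x y. label_word va vb R (map lab p)) \<in> cd_polys"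
      by (rule sum_label_word_in_cd[OF assms])
  qed
  finally show ?thesis .
qed

lemma rising_qsym_eq:
  "\<exists>c. rising_qsym R lab G x y = zscale c (QM []) + gamma (path_poly R lab x y)"
proof -
  let ?q = "\<lambda>p. QL (run_lengths R (map lab p))"
  have QL_Nil: "QL [] = QM []"
    using refinements_Nil by (simp add: QL_def refinements_def)
  have "rising_qsym R lab G x y = (\<Sum>p\<in>{p. awalk x p y \<and> p = []} \<union> {p. awalk x p y \<and> p \<noteq> []}. ?q p)"
    unfolding rising_qsym_def by (rule sum.cong) auto
  also have "\<dots> = (\<Sum>p\<in>{p. awalk x p y \<and> p = []}. ?q p) + (\<Sum>p | awalk x p y \<and> p \<noteq> []. ?q p)"
    using finite_nonempty_walks by (intro sum.union_disjoint) auto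
  also have "(\<Sum>p | awalk x p y \<and> p \<noteq> []. ?q p) = gamma (path_poly R lab x y)"
    unfolding path_poly_def additive.sum[OF gamma_additive]
    by (intro sum.cong) (auto simp: gamma_label_word)
  also have "(\<Sum>p\<in>{p. awalk x p y \<and> p = []}. ?q p) = zscale (of_bool (awalk x [] y)) (QM [])"
    by (auto simp: QL_Nil zscale_def fun_eq_iff conj_commute cong: conj_cong)
  finally show ?thesis by blast
qed

lemma rising_qsym_peak_iff:
  "rising_qsym R lab G x y \<in> peak_algebra \<longleftrightarrow> path_poly R lab x y \<in> cd_polys"
  using rising_qsym_eq[of R lab x y] gamma_peak_algebra_iff by metis

section \<open>From intervals to the whole graph\<close>

text \<open>Every vertex on a path from \<open>x\<close> to \<open>y\<close> is reachable from
  \<open>x\<close> and reaches \<open>y\<close>, so the path stays in the induced subgraph.\<close>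

lemma awalk_interval:
  "pre_digraph.awalk (interval G x y) x p y \<longleftrightarrow> awalk x p y"
proof
  have sub: "subgraph (interval G x y) G"
    unfolding interval_def
    by (rule induced_imp_subgraph[OF induced_induce]) (auto dest: reachable_in_verts)
  show "awalk x p y" if "pre_digraph.awalk (interval G x y) x p y"
    using that sub by (rule subgraph_awalk_imp_awalk)
next
  assume p: "awalk x p y"
  have verts: "set (awalk_verts x p) \<subseteq> between x y"
    using awalk_verts_reachable_from[OF p] awalk_verts_reachable_to[OF p] by (auto simp: between_def)
  have "tail G e \<in> between x y" "head G e \<in> between x y" if "e \<in> set p" for e
    using verts awalk_verts_arc1[OF that] awalk_verts_arc2[OF p that] by auto
  then have "set p \<subseteq> arcs (G \<restriction> between x y)"
    using p by (auto simp: awalk_def)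
  moreover have "x \<in> verts (G \<restriction> between x y)"
    using p by (auto simp: between_def awalk_def intro: reachable_awalkI[OF p] reachable_refl)
  moreover have "pre_digraph.cas (G \<restriction> between x y) x p y"
    using p by (simp add: compatible_cas[OF compatible_induce_subgraph] awalk_def)
  ultimately show "pre_digraph.awalk (interval G x y) x p y"
    by (simp add: pre_digraph.awalk_def interval_def flip: between_def)
qed

text \<open>Falling paths become rising paths of the negated relation, so that the preceding lemmas
  apply with both roles exchanged.\<close>

lemma interval_paths:
  "rising_paths R lab (interval G x y) x y k = rising_paths R lab G x y k"
  "falling_paths R lab (interval G x y) x y k = rising_paths (\<lambda>s t. \<not> R s t) lab G x y k"
  "rising_qsym R lab (interval G x y) x y = rising_qsym R lab G x y"
  by (simp_all add: rising_paths_def falling_paths_def rising_qsym_def awalk_interval)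

lemma rising_paths_unreachable: "\<not> x \<rightarrow>\<^sup>* y \<Longrightarrow> rising_paths R lab G x y k = {}"
  by (auto simp: rising_paths_def intro: reachable_awalkI)

end

theorem theorem6p9:
  fixes G :: "('v, 'e) pre_digraph"
    and lab :: "'e \<Rightarrow> 'l"
    and R :: "'l \<Rightarrow> 'l \<Rightarrow> bool"
  assumes "acyclic_locally_finite_digraph G"
  shows
    "((\<forall>x y k. x \<rightarrow>\<^sup>*\<^bsub>G\<^esub> y \<longrightarrow>
          card (rising_paths R lab (interval G x y) x y k) =
          card (falling_paths R lab (interval G x y) x y k))
      \<longleftrightarrow>
      (\<forall>x y k. x \<rightarrow>\<^sup>*\<^bsub>G\<^esub> y \<longrightarrow> even k \<and> k > 0 \<longrightarrow>
          card (rising_paths R lab (interval G x y) x y k) =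
          card (falling_paths R lab (interval G x y) x y k)))
     \<and>
     ((\<forall>x y k. x \<rightarrow>\<^sup>*\<^bsub>G\<^esub> y \<longrightarrow> even k \<and> k > 0 \<longrightarrow>
          card (rising_paths R lab (interval G x y) x y k) =
          card (falling_paths R lab (interval G x y) x y k))
      \<longleftrightarrow>
      (\<forall>x y. x \<rightarrow>\<^sup>*\<^bsub>G\<^esub> y \<longrightarrow>
          rising_qsym R lab (interval G x y) x y \<in> peak_algebra))"
    (is "(?i \<longleftrightarrow> ?ii) \<and> (?ii \<longleftrightarrow> ?iii)")
proof -
  interpret acyclic_locally_finite_digraph G by fact
  let ?R = "\<lambda>s t. \<not> R s t"
  \<comment> \<open>The inductions on length pass to other endpoints, so equality is needed for all
    pairs of vertices; for unreachable pairs both counts are 0.\<close>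
  have ii_all: "card (rising_paths R lab G x y k) = card (rising_paths ?R lab G x y k)" if ?ii for x y k
  proof (rule rising_eq_falling_if_even)
    fix k x y assume "even (k::nat)" "k > 0"
    then show "card (rising_paths R lab G x y k) = card (rising_paths ?R lab G x y k)"
      using \<open>?ii\<close> by (cases "x \<rightarrow>\<^sup>*\<^bsub>G\<^esub> y") (auto simp: interval_paths rising_paths_unreachable)
  qed
  have "?i \<longleftrightarrow> ?ii" using ii_all by (auto simp: interval_paths)
  moreover have ?iii if ?ii
    using path_poly_in_cd[OF ii_all[OF that]] by (simp add: interval_paths rising_qsym_peak_iff)
  moreover have ?ii if ?iii
    unfolding interval_paths
  proof (intro allI impI, elim conjE)
    fix x y and k :: nat assume "x \<rightarrow>\<^sup>*\<^bsub>G\<^esub> y" and k: "k > 0"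
    then have "path_poly R lab x y \<in> cd_polys"
      using that by (simp add: interval_paths rising_qsym_peak_iff)
    then show "card (rising_paths R lab G x y k) = card (rising_paths ?R lab G x y k)"
      using k by (rule path_poly_in_cd_imp)
  qed
  ultimately show ?thesis by blast
qed

end
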